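(* Let $F=\frac1n\sum_{i=1}^nF_i$, where each $F_i:\mathbb{R}^d\to\mathbb{R}^d$ is $L_i$-Lipschitz ($L_i>0$) and satisfies $\langle F_i(x)-F_i(x^* ),x-x^*\rangle\ge\mu_i\|x-x^*\|^2$ for all $x$, with (possibly negative) $\mu_i\in\mathbb{R}$, $|\mu_i|\le L_i$. Assume $\overline\mu=\frac1n\sum_{i:\mu_i\ge0}\mu_i+\frac4n\sum_{i:\mu_i<0}\mu_i>0$. Let $\xi^k$ be sampled uniformly from $\{1,\dots,n\}$, $L_{\max}=\max_iL_i$, $\sigma_{US*}^2=\frac1n\sum_{i=1}^n\|F_i(x^* )\|^2$. Let $K\ge0$, $k_0=\lceil K/2\rceil$, and define $\{\beta_k\}_{k\ge0}$ by: $\beta_k=1$ if $K\le\frac{48L_{\max}}{\overline\mu}$; $\beta_k=1$ if $K>\frac{48L_{\max}}{\overline\mu}$ and $k<k_0$; $\beta_k=\dfrac{96L_{\max}}{96L_{\max}+\overline\mu(k-k_0)}$ if $K>\frac{48L_{\max}}{\overline\mu}$ and $k\ge k_0$. Then the iterates of S-SEG with $\gamma_{1,\xi^k}=\frac{\beta_k}{6L_{\max}}$ and $\gamma_{2,\xi^k}=\frac14\gamma_{1,\xi^k}$ satisfy $$\mathbb{E}\left[\|x^K-x^*\|^2\right]\le\frac{1536L_{\max}\|x^0-x^*\|^2}{\overline\mu}\exp\left(-\frac{\overline\mu K}{96L_{\max}}\right)+\frac{1728\sigma_{US*}^2}{\overline\mu^2K}.$$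
   Context: $x^*\in\mathbb{R}^d$ satisfies $F(x^* )=0$, $\|\cdot\|$ is the Euclidean norm. The samples $\xi^0,\xi^1,\dots$ are independent. Same-sample stochastic extragradient (S-SEG), started at a deterministic $x^0$, is $x^{k+1}=x^k-\gamma_{2,\xi^k}F_{\xi^k}(x^k-\gamma_{1,\xi^k}F_{\xi^k}(x^k))$, $k\ge0$. *)

theory Defs
  imports "HOL-Probability.Probability"
begin

definition finite_sum_op :: "nat \<Rightarrow> (nat \<Rightarrow> 'a \<Rightarrow> 'a) \<Rightarrow> 'a \<Rightarrow> 'a::real_vector" where
  "finite_sum_op n F x = (1 / real n) *\<^sub>R (\<Sum>i=1..n. F i x)"

text \<open>Same-sample stochastic extragradient along one realisation \<open>s\<close> of the sample sequence:
  the sample \<open>s k\<close> is used in both the extrapolation and the update at step \<open>k\<close>.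
  The step sizes \<open>\<gamma>1 k i\<close>, \<open>\<gamma>2 k i\<close> may depend on the iteration \<open>k\<close> and on the sample \<open>i\<close>.\<close>

primrec s_seg ::
  "('i \<Rightarrow> 'a \<Rightarrow> 'a) \<Rightarrow> (nat \<Rightarrow> 'i \<Rightarrow> real) \<Rightarrow> (nat \<Rightarrow> 'i \<Rightarrow> real) \<Rightarrow> 'a \<Rightarrow> (nat \<Rightarrow> 'i) \<Rightarrow> nat \<Rightarrow> 'a::real_vector"
where
  "s_seg F \<gamma>1 \<gamma>2 x0 s 0 = x0"
| "s_seg F \<gamma>1 \<gamma>2 x0 s (Suc k) =
     (let x = s_seg F \<gamma>1 \<gamma>2 x0 s k
      in x - \<gamma>2 k (s k) *\<^sub>R F (s k) (x - \<gamma>1 k (s k) *\<^sub>R F (s k) x))"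

definition mu_bar :: "nat \<Rightarrow> (nat \<Rightarrow> real) \<Rightarrow> real" where
  "mu_bar n \<mu> = (1 / real n) * (\<Sum>i | i \<in> {1..n} \<and> \<mu> i \<ge> 0. \<mu> i)
              + (4 / real n) * (\<Sum>i | i \<in> {1..n} \<and> \<mu> i < 0. \<mu> i)"

definition L_max :: "nat \<Rightarrow> (nat \<Rightarrow> real) \<Rightarrow> real" where
  "L_max n L = Max (L ` {1..n})"

definition sigma_US_sq ::
  "nat \<Rightarrow> (nat \<Rightarrow> 'a \<Rightarrow> 'a) \<Rightarrow> 'a::real_normed_vector \<Rightarrow> real" where
  "sigma_US_sq n F xs = (1 / real n) * (\<Sum>i=1..n. (norm (F i xs))\<^sup>2)"

definition step_beta :: "real \<Rightarrow> real \<Rightarrow> nat \<Rightarrow> nat \<Rightarrow> real" where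
  "step_beta Lm mb K k =
     (let k0 = nat \<lceil>real K / 2\<rceil>
      in if real K \<le> 48 * Lm / mb then 1
         else if k < k0 then 1
         else 96 * Lm / (96 * Lm + mb * (real k - real k0)))"

end

theory Submission
  imports Defs
begin

text \<open>
  The result is a one-step contraction fed into a scalar recursion.

  Write \<open>z = y - xs\<close>, \<open>f = F i y\<close>, \<open>g = F i (y - \<gamma> f)\<close> and \<open>e = F i xs\<close>. One step changes \<open>\<parallel>z\<parallel>\<^sup>2\<close> by
  \<open>- (\<gamma>/2) \<langle>g, z\<rangle> + (\<gamma>\<^sup>2/16) \<parallel>g\<parallel>\<^sup>2\<close>. Since \<open>z\<close> is the extrapolated displacement \<open>z - \<gamma> f\<close> plus \<open>\<gamma> f\<close>,
  the inner product \<open>\<langle>g, z\<rangle>\<close> splits into a monotonicity term at the extrapolated point, a noise term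
  \<open>\<langle>e, z\<rangle> - \<gamma> \<langle>e, f\<rangle>\<close>, and \<open>\<gamma> \<langle>g, f\<rangle>\<close>. The last term is nearly
  \<open>(\<gamma>/2) (\<parallel>g\<parallel>\<^sup>2 + \<parallel>f\<parallel>\<^sup>2)\<close>, because \<open>g\<close> is close to \<open>f\<close> when \<open>\<gamma> L \<le> 1/6\<close>; it enters the step with a
  negative sign and pays for everything else, namely for \<open>\<parallel>g\<parallel>\<^sup>2\<close>, for \<open>\<langle>e, f\<rangle>\<close>, and for replacing
  \<open>\<mu> \<parallel>z - \<gamma> f\<parallel>\<^sup>2\<close> by a multiple of \<open>\<parallel>z\<parallel>\<^sup>2\<close>. That replacement loses a constant factor in opposite
  directions for positive and negative \<open>\<mu>\<close>, and the factor 4 in \<open>mu_bar\<close> is the ratio of the two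
  losses (\<open>curvature_after_extrapolation\<close>, \<open>seg_step_descent\<close>).

  Averaging over \<open>i\<close> removes the linear term \<open>\<langle>e, z\<rangle>\<close>, as \<open>xs\<close> is a zero of the mean operator.
  The current iterate is a function of the earlier samples, hence independent of the sample
  drawn next, so the averaged bound passes to expectations
  (\<open>expectation_fresh_uniform_sample\<close>).

  What remains is \<open>r (k + 1) \<le> (1 - a \<beta> k) r k + c (\<beta> k)\<^sup>2\<close> for the expected squared distance, with
  \<open>a = mu_bar / (48 L_max)\<close> and \<open>c = \<sigma>\<^sup>2 / (48 L_max\<^sup>2)\<close>. In a run with
  \<open>a K > 1\<close>, the steps \<open>\<beta> = 1\<close> of the first half make the
  contribution of \<open>r 0\<close> exponentially small and leave an error of order \<open>c / a\<close>; the steps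
  \<open>\<beta> = 2 / (2 + a j)\<close> of the second half reduce that error to order \<open>c / (a\<^sup>2 K)\<close>
  (\<open>switching_step_recursion\<close>).
\<close>

section \<open>One extragradient step along a fixed sample\<close>

lemma norm_diff_squared:
  fixes a b :: "'a::real_inner"
  shows "(norm (a - b))\<^sup>2 = (norm a)\<^sup>2 - 2 * (a \<bullet> b) + (norm b)\<^sup>2"
  by (simp add: power2_norm_eq_inner inner_diff_left inner_diff_right inner_commute)

lemma young_inner:
  fixes a b :: "'a::real_inner"
  assumes "t > 0"
  shows "2 * (a \<bullet> b) \<le> t * (norm a)\<^sup>2 + (norm b)\<^sup>2 / t"
proof -
  have "0 \<le> (norm (t *\<^sub>R a - b))\<^sup>2"
    by simp
  also have "\<dots> = t * (t * (norm a)\<^sup>2 + (norm b)\<^sup>2 / t - 2 * (a \<bullet> b))"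
    unfolding norm_diff_squared
    using assms by (simp add: field_simps power2_eq_square)
  finally show ?thesis
    using assms by (simp add: zero_le_mult_iff)
qed

text \<open>The weight that \<open>mu_bar\<close> averages.\<close>

definition penalized :: "real \<Rightarrow> real" where
  "penalized m = (if m \<ge> 0 then m else 4 * m)"

text \<open>
  For \<open>m \<ge> 0\<close> one needs \<open>\<parallel>z - v\<parallel>\<^sup>2\<close> from below, for \<open>m < 0\<close> from above. Young's inequality with weight
  \<open>3/8\<close> gives \<open>5/8 \<parallel>z\<parallel>\<^sup>2 - 5/3 \<parallel>v\<parallel>\<^sup>2\<close>, and with weight \<open>3/2\<close> it gives \<open>5/2 \<parallel>z\<parallel>\<^sup>2 + 5/3 \<parallel>v\<parallel>\<^sup>2\<close>. The
  weights are chosen so that the coefficients of \<open>\<parallel>z\<parallel>\<^sup>2\<close> have ratio 4 and those of \<open>\<parallel>v\<parallel>\<^sup>2\<close> agree in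
  absolute value.
\<close>

lemma curvature_after_extrapolation:
  fixes z v :: "'a::real_inner"
  assumes "\<bar>m\<bar> \<le> 1/6"
  shows "m * (norm (z - v))\<^sup>2 \<ge> 5/8 * penalized m * (norm z)\<^sup>2 - 5/18 * (norm v)\<^sup>2"
proof -
  have v6: "\<bar>m\<bar> * (5/3 * (norm v)\<^sup>2) \<le> 5/18 * (norm v)\<^sup>2"
    using mult_right_mono[OF assms, of "5/3 * (norm v)\<^sup>2"] by simp
  show ?thesis
  proof (cases "m \<ge> 0")
    case True
    have "(norm (z - v))\<^sup>2 \<ge> 5/8 * (norm z)\<^sup>2 - 5/3 * (norm v)\<^sup>2"
      unfolding norm_diff_squared using young_inner[of "3/8" z v] by simp
    from mult_left_mono[OF this True] v6 True show ?thesis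
      by (simp add: penalized_def algebra_simps)
  next
    case False
    have "(norm (z - v))\<^sup>2 \<le> 5/2 * (norm z)\<^sup>2 + 5/3 * (norm v)\<^sup>2"
      unfolding norm_diff_squared using young_inner[of "3/2" "- z" v] by simp
    from mult_left_mono_neg[OF this, of m] v6 False show ?thesis
      by (simp add: penalized_def algebra_simps)
  qed
qed

definition seg_step :: "('a \<Rightarrow> 'a) \<Rightarrow> real \<Rightarrow> 'a \<Rightarrow> 'a::real_vector" where
  "seg_step G \<gamma> y = y - (\<gamma> / 4) *\<^sub>R G (y - \<gamma> *\<^sub>R G y)"

text \<open>
  The coefficient of \<open>\<gamma>\<^sup>2 \<parallel>F y\<parallel>\<^sup>2\<close> collects \<open>5/36\<close> from the change of point in the curvature term,
  \<open>1/12\<close> from the noise and \<open>- 35/144\<close> from the polarisation identity; the total is negative.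
  The term linear in \<open>y - xs\<close> is kept, since it vanishes only after averaging.
\<close>

lemma seg_step_descent:
  fixes G :: "'a::real_inner \<Rightarrow> 'a"
  assumes lip: "L-lipschitz_on UNIV G"
    and mono: "\<And>y. (G y - G xs) \<bullet> (y - xs) \<ge> \<mu> * (norm (y - xs))\<^sup>2"
    and mu: "\<bar>\<mu>\<bar> \<le> L" and \<gamma>: "0 \<le> \<gamma>" "\<gamma> * L \<le> 1/6"
  shows "(norm (seg_step G \<gamma> y - xs))\<^sup>2 \<le> (norm (y - xs))\<^sup>2
           - 5/16 * (\<gamma> * penalized \<mu>) * (norm (y - xs))\<^sup>2
           - \<gamma> / 2 * (G xs \<bullet> (y - xs)) + 3/4 * \<gamma>\<^sup>2 * (norm (G xs))\<^sup>2"
proof -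
  define z f e where "z = y - xs" and "f = G y" and "e = G xs"
  define g where "g = G (y - \<gamma> *\<^sub>R f)"
  define A where "A = (g - e) \<bullet> (z - \<gamma> *\<^sub>R f)"
  have step: "(norm (seg_step G \<gamma> y - xs))\<^sup>2
      = (norm z)\<^sup>2 - \<gamma> / 2 * (g \<bullet> z) + \<gamma>\<^sup>2 / 16 * (norm g)\<^sup>2"
  proof -
    have "seg_step G \<gamma> y - xs = z - (\<gamma> / 4) *\<^sub>R g"
      by (simp add: seg_step_def z_def f_def g_def)
    then show ?thesis
      by (simp add: norm_diff_squared inner_commute power_mult_distrib power_divide)
  qed
  have split: "g \<bullet> z = A + e \<bullet> z - \<gamma> * (e \<bullet> f) + \<gamma> * (g \<bullet> f)"
    by (simp add: A_def inner_diff_left inner_diff_right algebra_simps)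
  have curv: "\<gamma> * A \<ge> 5/8 * (\<gamma> * penalized \<mu>) * (norm z)\<^sup>2 - 5/18 * \<gamma>\<^sup>2 * (norm f)\<^sup>2"
  proof -
    have "\<bar>\<gamma> * \<mu>\<bar> \<le> 1/6"
      using mult_left_mono[OF mu \<gamma>(1)] \<gamma> by (simp add: abs_mult)
    from curvature_after_extrapolation[OF this, of z "\<gamma> *\<^sub>R f"]
    have "\<gamma> * \<mu> * (norm (z - \<gamma> *\<^sub>R f))\<^sup>2
        \<ge> 5/8 * penalized (\<gamma> * \<mu>) * (norm z)\<^sup>2 - 5/18 * \<gamma>\<^sup>2 * (norm f)\<^sup>2"
      by (simp add: power_mult_distrib)
    moreover have "penalized (\<gamma> * \<mu>) = \<gamma> * penalized \<mu>"
      using \<gamma>(1) by (auto simp: penalized_def zero_le_mult_iff)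
    moreover have "\<gamma> * (\<mu> * (norm (z - \<gamma> *\<^sub>R f))\<^sup>2) \<le> \<gamma> * A"
    proof (rule mult_left_mono)
      have "y - \<gamma> *\<^sub>R f - xs = z - \<gamma> *\<^sub>R f"
        by (simp add: z_def)
      with mono[of "y - \<gamma> *\<^sub>R f"] show "\<mu> * (norm (z - \<gamma> *\<^sub>R f))\<^sup>2 \<le> A"
        by (simp add: A_def g_def e_def)
    qed (fact \<gamma>(1))
    ultimately show ?thesis
      by (simp add: mult.assoc)
  qed
  have polar: "2 * (g \<bullet> f) = (norm g)\<^sup>2 + (norm f)\<^sup>2 - (norm (g - f))\<^sup>2"
    by (simp add: norm_diff_squared)
  have close: "(norm (g - f))\<^sup>2 \<le> 1/36 * (norm f)\<^sup>2"
  proof -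
    have "norm (g - f) \<le> L * norm (\<gamma> *\<^sub>R f)"
      using lipschitz_onD[OF lip, of "y - \<gamma> *\<^sub>R f" y]
      by (simp add: g_def f_def dist_norm)
    also have "\<dots> = \<gamma> * L * norm f"
      using \<gamma>(1) by simp
    also have "\<dots> \<le> 1/6 * norm f"
      by (rule mult_right_mono[OF \<gamma>(2)]) simp
    finally have "(norm (g - f))\<^sup>2 \<le> (1/6 * norm f)\<^sup>2"
      by (rule power_mono) simp
    then show ?thesis
      by (simp add: power2_eq_square)
  qed
  \<comment> \<open>The weight 3 is what produces the factor \<open>3/4\<close> in front of the noise.\<close>
  have noise: "2 * (e \<bullet> f) \<le> 3 * (norm e)\<^sup>2 + (norm f)\<^sup>2 / 3"
    by (rule young_inner) simp
  have "2 * (g \<bullet> f) - 2 * (e \<bullet> f)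
      \<ge> (norm g)\<^sup>2 + (35/36 - 1/3) * (norm f)\<^sup>2 - 3 * (norm e)\<^sup>2"
    using polar close noise by (simp add: algebra_simps)
  from mult_left_mono[OF this, of "\<gamma>\<^sup>2"]
  have "\<gamma>\<^sup>2 * (2 * (g \<bullet> f) - 2 * (e \<bullet> f))
      \<ge> \<gamma>\<^sup>2 * (norm g)\<^sup>2 + 23/36 * (\<gamma>\<^sup>2 * (norm f)\<^sup>2) - 3 * (\<gamma>\<^sup>2 * (norm e)\<^sup>2)"
    by (simp add: algebra_simps)
  moreover have "4 * (\<gamma> * (g \<bullet> z)) = 4 * (\<gamma> * A) + 4 * (\<gamma> * (e \<bullet> z))
      + 2 * (\<gamma>\<^sup>2 * (2 * (g \<bullet> f) - 2 * (e \<bullet> f)))"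
    unfolding split by (simp add: algebra_simps power2_eq_square)
  moreover have "0 \<le> \<gamma>\<^sup>2 * (norm g)\<^sup>2" "0 \<le> \<gamma>\<^sup>2 * (norm f)\<^sup>2"
    by simp_all
  ultimately have "(norm z)\<^sup>2 - \<gamma> / 2 * (g \<bullet> z) + \<gamma>\<^sup>2 / 16 * (norm g)\<^sup>2
      \<le> (norm z)\<^sup>2 - 5/16 * (\<gamma> * penalized \<mu>) * (norm z)\<^sup>2
        - \<gamma> / 2 * (e \<bullet> z) + 3/4 * \<gamma>\<^sup>2 * (norm e)\<^sup>2"
    using curv by argo
  then show ?thesis
    unfolding step z_def e_def .
qed

section \<open>Averaging over the samples\<close>

lemma mu_bar_eq_mean_penalized:
  "mu_bar n \<mu> = (1 / real n) * (\<Sum>i=1..n. penalized (\<mu> i))"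
proof -
  have "(\<Sum>i=1..n. penalized (\<mu> i))
      = (\<Sum>i\<in>{1..n}. if \<mu> i \<ge> 0 then \<mu> i else 0) + (\<Sum>i\<in>{1..n}. if \<mu> i < 0 then 4 * \<mu> i else 0)"
    by (auto simp: sum.distrib[symmetric] penalized_def intro!: sum.cong)
  also have "\<dots> = (\<Sum>i | i \<in> {1..n} \<and> \<mu> i \<ge> 0. \<mu> i) + (\<Sum>i | i \<in> {1..n} \<and> \<mu> i < 0. 4 * \<mu> i)"
    by (simp add: sum.inter_filter[symmetric])
  finally show ?thesis
    by (simp add: mu_bar_def sum_distrib_left distrib_left mult.commute)
qed

lemma L_max_upper: "i \<in> {1..n} \<Longrightarrow> L i \<le> L_max n L"
  by (simp add: L_max_def)

lemma mu_bar_le_L_max: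
  assumes "n \<ge> 1" "\<And>i. i \<in> {1..n} \<Longrightarrow> \<bar>\<mu> i\<bar> \<le> L i"
  shows "mu_bar n \<mu> \<le> L_max n L"
proof -
  have "penalized (\<mu> i) \<le> L_max n L" if "i \<in> {1..n}" for i
    using assms(2)[OF that] L_max_upper[OF that, of L] by (auto simp: penalized_def)
  then have "(\<Sum>i=1..n. penalized (\<mu> i)) \<le> real n * L_max n L"
    using sum_bounded_above[of "{1..n}" "\<lambda>i. penalized (\<mu> i)" "L_max n L"] by simp
  then show ?thesis
    using assms(1) by (simp add: mu_bar_eq_mean_penalized field_simps)
qed

lemma mean_seg_step_descent:
  fixes F :: "nat \<Rightarrow> 'a::real_inner \<Rightarrow> 'a"
  assumes n: "n \<ge> 1"
    and lip: "\<And>i. i \<in> {1..n} \<Longrightarrow> (L i)-lipschitz_on UNIV (F i)"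
    and mono: "\<And>i y. i \<in> {1..n} \<Longrightarrow> (F i y - F i xs) \<bullet> (y - xs) \<ge> \<mu> i * (norm (y - xs))\<^sup>2"
    and mu: "\<And>i. i \<in> {1..n} \<Longrightarrow> \<bar>\<mu> i\<bar> \<le> L i"
    and sol: "finite_sum_op n F xs = 0"
    and \<gamma>: "0 \<le> \<gamma>" "\<gamma> * L_max n L \<le> 1/6"
  shows "(1 / real n) * (\<Sum>i=1..n. (norm (seg_step (F i) \<gamma> y - xs))\<^sup>2)
      \<le> (1 - 5/16 * (\<gamma> * mu_bar n \<mu>)) * (norm (y - xs))\<^sup>2 + 3/4 * \<gamma>\<^sup>2 * sigma_US_sq n F xs"
proof -
  have mean_zero: "(\<Sum>i=1..n. F i xs \<bullet> (y - xs)) = 0"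
    using sol n by (simp add: finite_sum_op_def inner_sum_left[symmetric])
  have "(\<Sum>i=1..n. (norm (seg_step (F i) \<gamma> y - xs))\<^sup>2)
      \<le> (\<Sum>i=1..n. (norm (y - xs))\<^sup>2
           - 5/16 * (\<gamma> * penalized (\<mu> i)) * (norm (y - xs))\<^sup>2
           - \<gamma> / 2 * (F i xs \<bullet> (y - xs)) + 3/4 * \<gamma>\<^sup>2 * (norm (F i xs))\<^sup>2)"
  proof (rule sum_mono)
    fix i assume i: "i \<in> {1..n}"
    have "\<gamma> * L i \<le> 1/6"
      using mult_left_mono[OF L_max_upper[OF i, of L] \<gamma>(1)] \<gamma>(2) by linarith
    from seg_step_descent[OF lip[OF i] mono[OF i] mu[OF i] \<gamma>(1) this]
    show "(norm (seg_step (F i) \<gamma> y - xs))\<^sup>2 \<le> (norm (y - xs))\<^sup>2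
           - 5/16 * (\<gamma> * penalized (\<mu> i)) * (norm (y - xs))\<^sup>2
           - \<gamma> / 2 * (F i xs \<bullet> (y - xs)) + 3/4 * \<gamma>\<^sup>2 * (norm (F i xs))\<^sup>2" .
  qed
  also have "\<dots> = real n * (norm (y - xs))\<^sup>2
      - 5/16 * (\<gamma> * (\<Sum>i=1..n. penalized (\<mu> i))) * (norm (y - xs))\<^sup>2
      - \<gamma> / 2 * (\<Sum>i=1..n. F i xs \<bullet> (y - xs)) + 3/4 * \<gamma>\<^sup>2 * (\<Sum>i=1..n. (norm (F i xs))\<^sup>2)"
    by (simp add: sum.distrib sum_subtractf sum_distrib_left sum_distrib_right)
  also have "\<dots> = real n * ((1 - 5/16 * (\<gamma> * mu_bar n \<mu>)) * (norm (y - xs))\<^sup>2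
      + 3/4 * \<gamma>\<^sup>2 * sigma_US_sq n F xs)"
    using n mean_zero
    by (simp add: mu_bar_eq_mean_penalized sigma_US_sq_def field_simps)
  finally show ?thesis
    using n by (simp add: field_simps)
qed

section \<open>Expectations along the sample sequence\<close>

text \<open>
  An iterate depends on the earlier samples only. This exhibits it as a function of finitely many
  coordinates of the sample sequence.
\<close>

lemma s_seg_restrict: "s_seg F \<gamma>1 \<gamma>2 x0 s k = s_seg F \<gamma>1 \<gamma>2 x0 (restrict s {..<k}) k"
proof -
  have cong: "(\<And>j. j < k \<Longrightarrow> s j = t j) \<Longrightarrow> s_seg F \<gamma>1 \<gamma>2 x0 s k = s_seg F \<gamma>1 \<gamma>2 x0 t k" for t
    by (induction k) (simp_all add: Let_def)
  show ?thesis
    by (rule cong) simp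
qed

context prob_space
begin

text \<open>
  A finite tuple of natural numbers lives in a countable space, where every function is measurable.
  Hence \<open>g\<close> may be arbitrary. This matters for the iterates, because nothing is known about the
  operators \<open>F i\<close> with an index outside \<open>{1..n}\<close>.
\<close>

lemma indep_past_present:
  fixes \<xi> :: "nat \<Rightarrow> 'a \<Rightarrow> nat" and g :: "(nat \<Rightarrow> nat) \<Rightarrow> real" and h :: "nat \<Rightarrow> real"
  assumes indep: "indep_vars (\<lambda>_. count_space UNIV) \<xi> UNIV"
  shows "indep_var borel (\<lambda>\<omega>. g (restrict (\<lambda>j. \<xi> j \<omega>) {..<k})) borel (\<lambda>\<omega>. h (\<xi> k \<omega>))"
proof -
  have "indep_var (PiM {..<k} (\<lambda>_. count_space UNIV)) (\<lambda>\<omega>. restrict (\<lambda>j. \<xi> j \<omega>) {..<k})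
      (PiM {k} (\<lambda>_. count_space UNIV)) (\<lambda>\<omega>. restrict (\<lambda>j. \<xi> j \<omega>) {k})"
    by (rule indep_var_restrict[OF indep]) auto
  moreover have "g \<in> borel_measurable (PiM {..<k} (\<lambda>_. count_space UNIV))"
    by (subst count_space_PiM_finite) auto
  moreover have "(\<lambda>s. h (s k)) \<in> borel_measurable (PiM {k} (\<lambda>_. count_space UNIV))"
    by (subst count_space_PiM_finite) auto
  ultimately have "indep_var borel (g \<circ> (\<lambda>\<omega>. restrict (\<lambda>j. \<xi> j \<omega>) {..<k}))
      borel ((\<lambda>s. h (s k)) \<circ> (\<lambda>\<omega>. restrict (\<lambda>j. \<xi> j \<omega>) {k}))"
    by (rule indep_var_compose)
  then show ?thesis
    by (simp add: comp_def)
qed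

lemma prob_uniform_sample:
  fixes Y :: "'a \<Rightarrow> nat"
  assumes Y: "Y \<in> measurable M (count_space UNIV)" and n: "n \<ge> 1"
    and unif: "distr M (count_space UNIV) Y = measure_pmf (pmf_of_set {1..n})"
    and i: "i \<in> {1..n}"
  shows "expectation (\<lambda>\<omega>. indicator {i} (Y \<omega>)) = 1 / real n"
proof -
  have "expectation (\<lambda>\<omega>. indicator {i} (Y \<omega>) :: real)
      = (\<integral>j. indicator {i} j \<partial>distr M (count_space UNIV) Y)"
    by (subst integral_distr[OF Y]) auto
  also have "\<dots> = pmf (pmf_of_set {1..n}) i"
    unfolding unif by (simp add: pmf.rep_eq)
  also have "\<dots> = 1 / real n"
    using n i by (subst pmf_of_set) auto
  finally show ?thesis .
qed

lemma AE_uniform_sample: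
  fixes Y :: "'a \<Rightarrow> nat"
  assumes Y: "Y \<in> measurable M (count_space UNIV)" and n: "n \<ge> 1"
    and unif: "distr M (count_space UNIV) Y = measure_pmf (pmf_of_set {1..n})"
  shows "AE \<omega> in M. Y \<omega> \<in> {1..n}"
proof -
  have "AE j in measure_pmf (pmf_of_set {1..n}). j \<in> {1..n}"
    using n by (simp add: AE_measure_pmf_iff set_pmf_of_set)
  then have "AE j in distr M (count_space UNIV) Y. j \<in> {1..n}"
    unfolding unif .
  then show ?thesis
    by (subst (asm) AE_distr_iff[OF Y]) auto
qed

text \<open>
  Conditioning on the past, without conditional expectations: almost surely \<open>\<Phi> (\<xi> k) X\<close> is the
  sum over \<open>i\<close> of \<open>\<Phi> i X\<close> times the indicator of \<open>\<xi> k = i\<close>, and each product factorises by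
  independence. The almost surely finite range of \<open>X\<close> makes all expectations finite.
\<close>

lemma expectation_fresh_uniform_sample:
  fixes \<xi> :: "nat \<Rightarrow> 'a \<Rightarrow> nat" and g :: "(nat \<Rightarrow> nat) \<Rightarrow> 'b" and \<Phi> :: "nat \<Rightarrow> 'b \<Rightarrow> real"
  defines "X \<equiv> \<lambda>k \<omega>. g (restrict (\<lambda>j. \<xi> j \<omega>) {..<k})"
  assumes indep: "indep_vars (\<lambda>_. count_space UNIV) \<xi> UNIV" and n: "n \<ge> 1"
    and unif: "distr M (count_space UNIV) (\<xi> k) = measure_pmf (pmf_of_set {1..n})"
    and fin: "finite A" "AE \<omega> in M. X k \<omega> \<in> A"
  shows "integrable M (\<lambda>\<omega>. \<Phi> i (X k \<omega>))"
    and "expectation (\<lambda>\<omega>. \<Phi> (\<xi> k \<omega>) (X k \<omega>))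
      = expectation (\<lambda>\<omega>. (1 / real n) * (\<Sum>i=1..n. \<Phi> i (X k \<omega>)))"
proof -
  have \<xi>: "\<xi> k \<in> measurable M (count_space UNIV)"
    using indep by (auto simp: indep_vars_def2)
  have ind: "indep_var borel (\<lambda>\<omega>. \<Phi> i (X k \<omega>)) borel (\<lambda>\<omega>. indicator {i} (\<xi> k \<omega>) :: real)" for i
    unfolding X_def by (rule indep_past_present[OF indep])
  have int: "integrable M (\<lambda>\<omega>. \<Phi> i (X k \<omega>))" for i
  proof (rule integrable_const_bound)
    show "AE \<omega> in M. norm (\<Phi> i (X k \<omega>)) \<le> (\<Sum>a\<in>A. \<bar>\<Phi> i a\<bar>)"
      using fin(2)
    proof eventually_elim
      case (elim \<omega>)
      with fin(1) show ?case
        using member_le_sum[of "X k \<omega>" A "\<lambda>a. \<bar>\<Phi> i a\<bar>"] by simp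
    qed
    show "(\<lambda>\<omega>. \<Phi> i (X k \<omega>)) \<in> borel_measurable M"
      using indep_var_rv1[OF ind] by simp
  qed
  show "integrable M (\<lambda>\<omega>. \<Phi> i (X k \<omega>))"
    by (fact int)
  have int1: "integrable M (\<lambda>\<omega>. indicator {i} (\<xi> k \<omega>) :: real)" for i
  proof (rule integrable_const_bound[where B = 1])
    show "(\<lambda>\<omega>. indicator {i} (\<xi> k \<omega>) :: real) \<in> borel_measurable M"
      using indep_var_rv2[OF ind] by simp
  qed (auto simp: indicator_def)
  have prod: "expectation (\<lambda>\<omega>. \<Phi> i (X k \<omega>) * indicator {i} (\<xi> k \<omega>))
      = expectation (\<lambda>\<omega>. \<Phi> i (X k \<omega>)) * (1 / real n)" if "i \<in> {1..n}" for i
    using indep_var_lebesgue_integral[OF ind int int1]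
      prob_uniform_sample[OF \<xi> n unif that] by simp
  have meas: "(\<lambda>\<omega>. \<Phi> (\<xi> k \<omega>) (X k \<omega>)) \<in> borel_measurable M"
    by (rule measurable_compose_countable'[where I = UNIV, OF _ \<xi>])
      (use int in \<open>auto dest: borel_measurable_integrable\<close>)
  have "expectation (\<lambda>\<omega>. \<Phi> (\<xi> k \<omega>) (X k \<omega>))
      = expectation (\<lambda>\<omega>. \<Sum>i=1..n. \<Phi> i (X k \<omega>) * indicator {i} (\<xi> k \<omega>))"
  proof (rule integral_cong_AE)
    show "(\<lambda>\<omega>. \<Sum>i=1..n. \<Phi> i (X k \<omega>) * indicator {i} (\<xi> k \<omega>)) \<in> borel_measurable M"
      using int int1 by (intro borel_measurable_sum borel_measurable_times)
        (auto dest: borel_measurable_integrable)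
    show "AE \<omega> in M. \<Phi> (\<xi> k \<omega>) (X k \<omega>) = (\<Sum>i=1..n. \<Phi> i (X k \<omega>) * indicator {i} (\<xi> k \<omega>))"
      using AE_uniform_sample[OF \<xi> n unif]
    proof eventually_elim
      case (elim \<omega>)
      have "(\<Sum>i=1..n. \<Phi> i (X k \<omega>) * indicator {i} (\<xi> k \<omega>))
          = (\<Sum>i=1..n. if i = \<xi> k \<omega> then \<Phi> i (X k \<omega>) else 0)"
        by (intro sum.cong) auto
      with elim show ?case
        by simp
    qed
  qed (fact meas)
  also have "\<dots> = (\<Sum>i=1..n. expectation (\<lambda>\<omega>. \<Phi> i (X k \<omega>) * indicator {i} (\<xi> k \<omega>)))"
    by (intro Bochner_Integration.integral_sum indep_var_integrable[OF ind int int1])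
  also have "\<dots> = (\<Sum>i=1..n. expectation (\<lambda>\<omega>. \<Phi> i (X k \<omega>)) * (1 / real n))"
    by (intro sum.cong refl prod)
  also have "\<dots> = expectation (\<lambda>\<omega>. (1 / real n) * (\<Sum>i=1..n. \<Phi> i (X k \<omega>)))"
    using int by (simp add: sum_divide_distrib)
  finally show "expectation (\<lambda>\<omega>. \<Phi> (\<xi> k \<omega>) (X k \<omega>))
      = expectation (\<lambda>\<omega>. (1 / real n) * (\<Sum>i=1..n. \<Phi> i (X k \<omega>)))" .
qed

text \<open>
  From a deterministic starting point, each step multiplies the number of reachable points by at
  most \<open>n\<close>. This supplies integrability of every function of the iterate.
\<close>

lemma s_seg_AE_finite:
  fixes \<xi> :: "nat \<Rightarrow> 'a \<Rightarrow> nat" and F :: "nat \<Rightarrow> 'b \<Rightarrow> 'b::real_vector"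
  assumes "\<And>k. AE \<omega> in M. \<xi> k \<omega> \<in> {1..n}"
  shows "\<exists>A. finite A \<and> (AE \<omega> in M. s_seg F \<gamma>1 \<gamma>2 x0 (\<lambda>j. \<xi> j \<omega>) k \<in> A)"
proof (induction k)
  case 0
  show ?case
    by (intro exI[of _ "{x0}"]) simp
next
  case (Suc k)
  then obtain A where A: "finite A" "AE \<omega> in M. s_seg F \<gamma>1 \<gamma>2 x0 (\<lambda>j. \<xi> j \<omega>) k \<in> A"
    by blast
  let ?step = "\<lambda>(i, y). y - \<gamma>2 k i *\<^sub>R F i (y - \<gamma>1 k i *\<^sub>R F i y)"
  have "AE \<omega> in M. s_seg F \<gamma>1 \<gamma>2 x0 (\<lambda>j. \<xi> j \<omega>) (Suc k) \<in> ?step ` ({1..n} \<times> A)"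
    using A(2) assms[of k]
  proof eventually_elim
    case (elim \<omega>)
    then show ?case
      by (auto simp: Let_def intro!: rev_image_eqI)
  qed
  with A(1) show ?case
    by (intro exI[of _ "?step ` ({1..n} \<times> A)"]) auto
qed

end

section \<open>The scalar recursion under the switching step-size rule\<close>

lemma constant_step_recursion:
  fixes r :: "nat \<Rightarrow> real"
  assumes a: "0 < a" "a \<le> 1" and c: "0 \<le> c"
    and rec: "\<And>k. k < m \<Longrightarrow> r (Suc k) \<le> (1 - a) * r k + c"
  shows "r m \<le> (1 - a) ^ m * r 0 + c / a"
  using rec
proof (induction m)
  case 0
  show ?case using a c by simp
next
  case (Suc m)
  then have "r m \<le> (1 - a) ^ m * r 0 + c / a"
    by simp
  then have "(1 - a) * r m \<le> (1 - a) * ((1 - a) ^ m * r 0 + c / a)"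
    using a by (intro mult_left_mono) auto
  also have "\<dots> + c = (1 - a) ^ Suc m * r 0 + c / a"
    using a by (simp add: field_simps)
  finally show ?case
    using Suc.prems[of m] by simp
qed

text \<open>
  With \<open>u j = 2 + a j\<close> the contraction factor is \<open>(u j - 2 a) / u j\<close>, and
  \<open>u j (u j - 2 a) \<le> (u j - a)\<^sup>2 = (u (j - 1))\<^sup>2\<close>. So \<open>(u (j - 1))\<^sup>2 r j\<close> grows by at most \<open>4 c\<close> per step.
\<close>

lemma decreasing_step_recursion:
  fixes r :: "nat \<Rightarrow> real"
  assumes a: "0 < a" and nonneg: "\<And>j. 0 \<le> r j"
    and rec: "\<And>j. j < J \<Longrightarrow>
      r (Suc j) \<le> (1 - a * (2 / (2 + a * real j))) * r j + c * (2 / (2 + a * real j))\<^sup>2"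
  shows "(2 + a * (real J - 1))\<^sup>2 * r J \<le> (2 - a)\<^sup>2 * r 0 + 4 * c * real J"
  using rec
proof (induction J)
  case 0
  show ?case by simp
next
  case (Suc J)
  define u where "u = 2 + a * real J"
  have u: "u > 0"
    using a by (simp add: u_def add_pos_nonneg)
  have "u\<^sup>2 * r (Suc J) \<le> u\<^sup>2 * ((1 - a * (2 / u)) * r J + c * (2 / u)\<^sup>2)"
    using Suc.prems[of J] unfolding u_def by (intro mult_left_mono) auto
  also have "\<dots> = (u - 2 * a) * u * r J + 4 * c"
    using u by (simp add: field_simps power2_eq_square)
  also have "(u - 2 * a) * u * r J \<le> (u - a)\<^sup>2 * r J"
    using nonneg by (intro mult_right_mono) (auto simp: power2_eq_square algebra_simps)
  also have "(u - a)\<^sup>2 * r J \<le> (2 - a)\<^sup>2 * r 0 + 4 * c * real J"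
    using Suc by (simp add: u_def algebra_simps)
  finally show ?case
    by (simp add: u_def algebra_simps)
qed

lemma step_beta_bounds:
  assumes "Lm > 0" "mb > 0"
  shows "0 < step_beta Lm mb K k" "step_beta Lm mb K k \<le> 1"
proof -
  define k0 where "k0 = nat \<lceil>real K / 2\<rceil>"
  have decay: "0 < 96 * Lm / (96 * Lm + t)" "96 * Lm / (96 * Lm + t) \<le> 1" if "0 \<le> t" for t
    using assms that by (simp_all add: add_pos_nonneg)
  have "0 \<le> mb * (real k - real k0)" if "\<not> k < k0"
    using assms that by simp
  with decay show "0 < step_beta Lm mb K k" "step_beta Lm mb K k \<le> 1"
    unfolding step_beta_def Let_def k0_def[symmetric] by simp_all
qed

text \<open>
  If \<open>K > 0\<close> and \<open>a K \<le> 1\<close>, the stationary error \<open>c / a\<close> of constant steps is already below \<open>c / (a\<^sup>2 K)\<close>.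
  If \<open>a K > 1\<close>, the second half of the run divides the error \<open>c / a\<close> left by the first half by a
  factor of order \<open>(a K)\<^sup>2\<close>, and adds an error of order \<open>c K / (a K)\<^sup>2\<close>.
\<close>

lemma switching_step_recursion:
  fixes r :: "nat \<Rightarrow> real"
  assumes Lm: "Lm > 0" and mb: "mb > 0" and a_def: "a = mb / (48 * Lm)" and a1: "a \<le> 1"
    and c: "0 \<le> c" and nonneg: "\<And>k. 0 \<le> r k"
    and rec: "\<And>k. r (Suc k)
      \<le> (1 - a * step_beta Lm mb K k) * r k + c * (step_beta Lm mb K k)\<^sup>2"
  shows "r K \<le> 32 * r 0 / a * exp (- (a * real K / 2)) + 36 * c / (a\<^sup>2 * real K)"
proof -
  have a0: "a > 0"
    using Lm mb by (simp add: a_def)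
  have inv_a: "1 \<le> 1 / a"
    using a0 a1 by simp
  have small_iff: "real K \<le> 48 * Lm / mb \<longleftrightarrow> a * real K \<le> 1"
    using Lm mb by (simp add: a_def field_simps)
  have geom: "(1 - a) ^ m \<le> exp (- (a * real K / 2))" if "real K / 2 \<le> real m" for m
  proof -
    have "(1 - a) ^ m \<le> exp (- a) ^ m"
      using a1 exp_ge_add_one_self[of "- a"] by (intro power_mono) auto
    also have "\<dots> = exp (- (a * real m))"
      by (simp add: exp_of_nat_mult[symmetric] mult.commute)
    also have "\<dots> \<le> exp (- (a * real K / 2))"
      using mult_left_mono[OF that, of a] a0 by simp
    finally show ?thesis .
  qed
  have r0: "r 0 \<le> 32 * r 0 / a * 1"
    using mult_left_mono[of 1 "32 / a" "r 0"] inv_a nonneg[of 0] by (simp add: field_simps)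
  show ?thesis
  proof (cases "K = 0")
    case True
    \<comment> \<open>The second summand is a quotient by zero here, hence 0, and \<open>1 \<le> 32 / a\<close> suffices.\<close>
    with r0 show ?thesis by simp
  next
    case False
    then have K: "real K > 0" by simp
    define k0 where "k0 = nat \<lceil>real K / 2\<rceil>"
    have k0_less: "2 * real k0 < real K + 2"
      unfolding k0_def by linarith
    have k0: "real K / 2 \<le> real k0" "2 * real k0 \<le> real K + 1"
    proof -
      show "real K / 2 \<le> real k0"
        unfolding k0_def by linarith
      have "2 * k0 < K + 2"
        using k0_less by linarith
      then show "2 * real k0 \<le> real K + 1"
        by linarith
    qed
    have switch: "step_beta Lm mb K k = (if a * real K \<le> 1 then 1 else if k < k0 then 1
        else 96 * Lm / (96 * Lm + mb * (real k - real k0)))" for k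
      unfolding step_beta_def Let_def small_iff k0_def ..
    show ?thesis
    proof (cases "a * real K \<le> 1")
      case True
      have "r (Suc k) \<le> (1 - a) * r k + c" for k
        using rec[of k] True unfolding switch by simp
      from constant_step_recursion[where m = K and r = r, OF a0 a1 c this]
      have "r K \<le> (1 - a) ^ K * r 0 + c / a" by simp
      also have "(1 - a) ^ K * r 0 \<le> exp (- (a * real K / 2)) * (32 * r 0 / a * 1)"
        using geom[of K] r0 nonneg[of 0] a1 by (intro mult_mono) auto
      also have "c / a \<le> 36 * c / (a\<^sup>2 * real K)"
      proof -
        have "c * (a * real K) \<le> 36 * c"
          using mult_left_mono[OF True c] c by simp
        then show ?thesis
          using a0 K by (simp add: field_simps power2_eq_square)
      qed
      finally show ?thesis
        by (simp add: mult.commute)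
    next
      case False
      then have aK: "a * real K > 1" by simp
      define J where "J = K - k0"
      have kJ: "K = k0 + J"
        using k0 K by (simp add: J_def)
      have "r (Suc k) \<le> (1 - a) * r k + c" if "k < k0" for k
        using rec[of k] False that unfolding switch by simp
      from constant_step_recursion[where m = k0 and r = r, OF a0 a1 c this]
      have "r k0 \<le> (1 - a) ^ k0 * r 0 + c / a" by simp
      also have "(1 - a) ^ k0 * r 0 \<le> exp (- (a * real K / 2)) * r 0"
        using geom[OF k0(1)] nonneg[of 0] by (rule mult_right_mono)
      finally have first: "r k0 \<le> exp (- (a * real K / 2)) * r 0 + c / a"
        by simp
      have beta: "step_beta Lm mb K (k0 + j) = 2 / (2 + a * real j)" for j
      proof -
        have "step_beta Lm mb K (k0 + j) = 96 * Lm / (96 * Lm + mb * real j)"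
          using False unfolding switch by simp
        also have "\<dots> = 2 / (2 + a * real j)"
          using Lm mb by (simp add: a_def field_simps add_pos_nonneg)
        finally show ?thesis .
      qed
      \<comment> \<open>The weight that the decreasing steps have accumulated after \<open>J\<close> iterations.\<close>
      define P where "P = (2 + a * (real J - 1))\<^sup>2"
      have "P * r (k0 + J) \<le> (2 - a)\<^sup>2 * r (k0 + 0) + 4 * c * real J"
        unfolding P_def
        using rec[of "k0 + j" for j] nonneg
        by (intro decreasing_step_recursion[OF a0, of "\<lambda>j. r (k0 + j)"]) (simp_all add: beta)
      also have "(2 - a)\<^sup>2 * r (k0 + 0) \<le> 4 * r k0"
        using a0 a1 nonneg[of k0] power_mono[of "2 - a" 2 2] by (simp add: mult_right_mono)
      also note first
      also have "4 * c * real J \<le> 2 * c * real K"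
        using k0 kJ c mult_left_mono[of "2 * real J" "real K" "2 * c"] by simp
      finally have PrK: "P * r K \<le> 4 * (exp (- (a * real K / 2)) * r 0) + (4 * (c / a) + 2 * c * real K)"
        using kJ by simp
      have "a * real K / 2 \<le> a * (real J - 1) + 3 / 2 * a"
      proof -
        have "real K / 2 \<le> real J - 1 + 3 / 2"
          using k0 kJ by simp
        from mult_left_mono[OF this, of a] a0 show ?thesis
          by (simp add: algebra_simps)
      qed
      then have root: "a * real K / 2 + 1 / 2 \<le> 2 + a * (real J - 1)"
        using a1 by linarith
      have P1: "1 \<le> P"
        unfolding P_def using root aK by (intro one_le_power) linarith
      have PK: "(a * real K / 2)\<^sup>2 \<le> P"
        unfolding P_def using root aK by (intro power_mono) linarith+
      have "4 * (c / a) \<le> 4 * c * real K"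
        using aK a0 c mult_left_mono[of 1 "a * real K" "4 * c"] by (simp add: field_simps)
      then have cK: "4 * (c / a) + 2 * c * real K \<le> 6 * c * real K"
        by simp
      have "6 * c * real K = 24 * c / (a\<^sup>2 * real K) * (a * real K / 2)\<^sup>2"
        using a0 K by (simp add: field_simps power2_eq_square)
      also have "\<dots> \<le> 24 * c / (a\<^sup>2 * real K) * P"
        using PK c K by (intro mult_left_mono) auto
      also have "\<dots> \<le> 36 * c / (a\<^sup>2 * real K) * P"
        using c K P1 by (intro mult_right_mono divide_right_mono) auto
      finally have noise: "4 * (c / a) + 2 * c * real K \<le> 36 * c / (a\<^sup>2 * real K) * P"
        using cK by linarith
      have "4 * (exp (- (a * real K / 2)) * r 0)
          \<le> 32 * r 0 / a * exp (- (a * real K / 2)) * 1"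
      proof -
        have "4 * r 0 \<le> 32 * r 0 / a"
          using r0 inv_a mult_left_mono[of 1 "1 / a" "32 * r 0"] nonneg[of 0] by simp
        from mult_right_mono[OF this, of "exp (- (a * real K / 2))"] show ?thesis
          by (simp add: ac_simps)
      qed
      also have "\<dots> \<le> 32 * r 0 / a * exp (- (a * real K / 2)) * P"
        using P1 a0 nonneg[of 0] by (intro mult_left_mono) auto
      finally have "P * r K \<le> P * (32 * r 0 / a * exp (- (a * real K / 2)) + 36 * c / (a\<^sup>2 * real K))"
        using PrK noise by (simp add: algebra_simps)
      then show ?thesis
        using P1 by simp
    qed
  qed
qed

section \<open>Convergence of same-sample stochastic extragradient\<close>

theorem corollaryE3:
  fixes F :: "nat \<Rightarrow> (real ^ 'd) \<Rightarrow> (real ^ 'd)"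
    and L \<mu> :: "nat \<Rightarrow> real"
    and n K :: nat
    and xs x0 :: "real ^ 'd"
    and M :: "'w measure"
    and \<xi> :: "nat \<Rightarrow> 'w \<Rightarrow> nat"
    and \<gamma>1 \<gamma>2 :: "nat \<Rightarrow> nat \<Rightarrow> real"
    and x :: "nat \<Rightarrow> 'w \<Rightarrow> real ^ 'd"
  assumes n_pos: "n \<ge> 1"
    and L_pos: "\<And>i. i \<in> {1..n} \<Longrightarrow> L i > 0"
    and lipschitz: "\<And>i. i \<in> {1..n} \<Longrightarrow> (L i)-lipschitz_on UNIV (F i)"
    and quasi_strongly_monotone:
      "\<And>i y. i \<in> {1..n} \<Longrightarrow> (F i y - F i xs) \<bullet> (y - xs) \<ge> \<mu> i * (norm (y - xs))\<^sup>2"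
    and mu_bound: "\<And>i. i \<in> {1..n} \<Longrightarrow> \<bar>\<mu> i\<bar> \<le> L i"
    and solution: "finite_sum_op n F xs = 0"
    and mu_bar_pos: "mu_bar n \<mu> > 0"
    and prob: "prob_space M"
    and indep: "prob_space.indep_vars M (\<lambda>_. count_space UNIV) \<xi> UNIV"
    and uniform: "\<And>k. distr M (count_space UNIV) (\<xi> k) = measure_pmf (pmf_of_set {1..n})"
    and step1: "\<And>k i. \<gamma>1 k i = step_beta (L_max n L) (mu_bar n \<mu>) K k / (6 * L_max n L)"
    and step2: "\<And>k i. \<gamma>2 k i = \<gamma>1 k i / 4"
    and iterates: "\<And>k \<omega>. x k \<omega> = s_seg F \<gamma>1 \<gamma>2 x0 (\<lambda>j. \<xi> j \<omega>) k"
  shows "integrable M (\<lambda>\<omega>. (norm (x K \<omega> - xs))\<^sup>2) \<and>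
    (\<integral>\<omega>. (norm (x K \<omega> - xs))\<^sup>2 \<partial>M)
      \<le> 1536 * L_max n L * (norm (x0 - xs))\<^sup>2 / mu_bar n \<mu>
            * exp (- (mu_bar n \<mu> * real K / (96 * L_max n L)))
        + 1728 * sigma_US_sq n F xs / ((mu_bar n \<mu>)\<^sup>2 * real K)"
proof -
  interpret prob_space M by (fact prob)
  define Lm mb where "Lm = L_max n L" and "mb = mu_bar n \<mu>"
  define a c where "a = mb / (48 * Lm)" and "c = sigma_US_sq n F xs / (48 * Lm\<^sup>2)"
  define \<beta> where "\<beta> = step_beta Lm mb K"
  define \<gamma> where "\<gamma> k = \<beta> k / (6 * Lm)" for k
  define r where "r k = expectation (\<lambda>\<omega>. (norm (x k \<omega> - xs))\<^sup>2)" for k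
  have mb: "mb > 0"
    using mu_bar_pos by (simp add: mb_def)
  have mb_le: "mb \<le> Lm"
    unfolding mb_def Lm_def using n_pos mu_bound by (rule mu_bar_le_L_max)
  with mb have Lm: "Lm > 0"
    by simp
  have \<xi>: "\<xi> k \<in> measurable M (count_space UNIV)" for k
    using indep by (auto simp: indep_vars_def2)
  have past: "x k \<omega> = s_seg F \<gamma>1 \<gamma>2 x0 (restrict (\<lambda>j. \<xi> j \<omega>) {..<k}) k" for k \<omega>
    unfolding iterates by (rule s_seg_restrict)
  have "\<exists>A. finite A \<and> (AE \<omega> in M. x k \<omega> \<in> A)" for k
    unfolding iterates
    using AE_uniform_sample[OF \<xi> n_pos uniform] by (rule s_seg_AE_finite)
  then obtain A where A: "finite (A k)" "AE \<omega> in M. x k \<omega> \<in> A k" for k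
    by metis
  note sampling = expectation_fresh_uniform_sample[OF indep n_pos uniform A(1) A(2)[unfolded past],
      folded past]
  have int: "integrable M (\<lambda>\<omega>. (norm (x k \<omega> - xs))\<^sup>2)" for k
    by (rule sampling(1)[of "\<lambda>_ y. (norm (y - xs))\<^sup>2" 0])
  have step: "x (Suc k) \<omega> = seg_step (F (\<xi> k \<omega>)) (\<gamma> k) (x k \<omega>)" for k \<omega>
    by (simp add: iterates seg_step_def Let_def step1 step2 \<gamma>_def \<beta>_def Lm_def mb_def)
  \<comment> \<open>The averaged step contracts by \<open>1 - (5/16) \<gamma> mb\<close>, and \<open>a \<beta> k\<close> equals \<open>(1/8) \<gamma> mb\<close>.\<close>
  have rec: "r (Suc k) \<le> (1 - a * \<beta> k) * r k + c * (\<beta> k)\<^sup>2" for k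
  proof -
    have \<beta>: "0 < \<beta> k" "\<beta> k \<le> 1"
      unfolding \<beta>_def using step_beta_bounds[OF Lm mb] by auto
    have \<gamma>: "0 \<le> \<gamma> k" "\<gamma> k * L_max n L \<le> 1/6"
      using \<beta> Lm by (simp_all add: \<gamma>_def Lm_def[symmetric] field_simps)
    have "r (Suc k) = expectation (\<lambda>\<omega>. (1 / real n) *
        (\<Sum>i=1..n. (norm (seg_step (F i) (\<gamma> k) (x k \<omega>) - xs))\<^sup>2))"
      unfolding r_def step
      by (rule sampling(2)[of "\<lambda>i y. (norm (seg_step (F i) (\<gamma> k) y - xs))\<^sup>2"])
    also have "\<dots> \<le> expectation (\<lambda>\<omega>. (1 - 5/16 * (\<gamma> k * mb)) * (norm (x k \<omega> - xs))\<^sup>2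
        + 3/4 * (\<gamma> k)\<^sup>2 * sigma_US_sq n F xs)"
    proof (rule integral_mono)
      show "integrable M (\<lambda>\<omega>. (1 / real n) *
          (\<Sum>i=1..n. (norm (seg_step (F i) (\<gamma> k) (x k \<omega>) - xs))\<^sup>2))"
        using sampling(1)[of "\<lambda>i y. (norm (seg_step (F i) (\<gamma> k) y - xs))\<^sup>2"]
        by (intro integrable_mult_right Bochner_Integration.integrable_sum)
      show "integrable M (\<lambda>\<omega>. (1 - 5/16 * (\<gamma> k * mb)) * (norm (x k \<omega> - xs))\<^sup>2
          + 3/4 * (\<gamma> k)\<^sup>2 * sigma_US_sq n F xs)"
        using int by simp
    qed (unfold mb_def,
        rule mean_seg_step_descent[OF n_pos lipschitz quasi_strongly_monotone mu_bound solution \<gamma>])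
    also have "\<dots> = (1 - 5/16 * (\<gamma> k * mb)) * r k + 3/4 * (\<gamma> k)\<^sup>2 * sigma_US_sq n F xs"
      using int by (simp add: r_def prob_space)
    also have "\<dots> \<le> (1 - a * \<beta> k) * r k + 3/4 * (\<gamma> k)\<^sup>2 * sigma_US_sq n F xs"
    proof -
      have "a * \<beta> k \<le> 5/16 * (\<gamma> k * mb)"
        using Lm mb \<beta> by (simp add: a_def \<gamma>_def field_simps)
      moreover have "0 \<le> r k"
        by (simp add: r_def)
      ultimately show ?thesis
        by (simp add: mult_right_mono)
    qed
    also have "3/4 * (\<gamma> k)\<^sup>2 * sigma_US_sq n F xs = c * (\<beta> k)\<^sup>2"
      by (simp add: c_def \<gamma>_def power_divide power_mult_distrib)
    finally show ?thesis .
  qed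
  have bound: "r K \<le> 32 * r 0 / a * exp (- (a * real K / 2)) + 36 * c / (a\<^sup>2 * real K)"
  proof (rule switching_step_recursion[OF Lm mb a_def])
    show "a \<le> 1"
      using mb_le Lm by (simp add: a_def field_simps)
    show "0 \<le> c"
      by (simp add: c_def sigma_US_sq_def sum_nonneg)
    show "0 \<le> r k" for k
      by (simp add: r_def)
    show "r (Suc k) \<le> (1 - a * step_beta Lm mb K k) * r k + c * (step_beta Lm mb K k)\<^sup>2" for k
      using rec[of k] by (simp add: \<beta>_def)
  qed
  have start: "r 0 = (norm (x0 - xs))\<^sup>2"
    by (simp add: r_def iterates prob_space)
  have bias: "32 * (norm (x0 - xs))\<^sup>2 / a = 1536 * Lm * (norm (x0 - xs))\<^sup>2 / mb"
    by (simp add: a_def)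
  have rate: "a * real K / 2 = mb * real K / (96 * Lm)"
    by (simp add: a_def)
  have noise: "36 * c / (a\<^sup>2 * real K) = 1728 * sigma_US_sq n F xs / (mb\<^sup>2 * real K)"
    using Lm by (simp add: a_def c_def power_divide power_mult_distrib)
  show ?thesis
    using int[of K] bound[unfolded start bias rate noise] unfolding r_def Lm_def mb_def by (rule conjI)
qed

end
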